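(* Let $X$ be a Hausdorff space, let $Z$ be a Hausdorff topological vector space, let $C\subseteq Z$ be a convex and pointed cone with nonempty interior, and let $K$ be a nonempty and closed subset of $X$. Let $y\in K$ and consider a mapping $g:K\times K\to Z$. Assume that one of the following conditions holds. (a) The mapping $x\mapsto g(x,y)$ is $C$-upper semicontinuous on $K$. (b) For every $x\in K$ and for every net $(x_\alpha)\subseteq K$ with $\lim x_\alpha=x$ there exists a net $(z_\alpha)\subseteq Z$ with $\lim z_\alpha=z\in Z$ such that $g(x_\alpha,y)-z_\alpha\in -C$ for all $\alpha$ and $g(x,y)-z\in C$. Then the set $G_g(y)=\{x\in K: g(x,y)\notin-\operatorname{int} C\}$ is closed.
   Context: Topological vector spaces are real. A set $C\subseteq Z$ is a cone if $tc\in C$ for all $c\in C$, $t\ge 0$; it is convex if $C+C=C$ and pointed if $C\cap(-C)=\{0\}$. $\operatorname{int} C$ is the topological interior. Nets carrying the same index $\alpha$ are indexed by the same directed set. A map $h:K\to Z$ is $C$-upper semicontinuous at $x\in K$ if for any neighborhood $V$ of $h(x)$ there exists a neighborhood $U$ of $x$ such that $h(u)\in V-C$ for all $u\in U\cap K$. It is $C$-upper semicontinuous on $K$ if it is so at every $x\in K$. *)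

theory Defs
  imports "HOL-Analysis.Analysis"
begin

class real_topological_vector_space = real_vector + topological_ab_group_add +
  assumes tendsto_scaleR_Pair:
    "LIM p (nhds t \<times>\<^sub>F nhds a). fst p *\<^sub>R snd p :> nhds (t *\<^sub>R a)"

text \<open>
  For the cones below, convexity is expressed by \<open>C + C = C\<close>, where \<open>+\<close> is the
  Minkowski sum of sets.
\<close>

definition convex_pointed_cone :: "'z::real_vector set \<Rightarrow> bool" where
  "convex_pointed_cone C \<longleftrightarrow> cone C \<and> C + C = C \<and> C \<inter> uminus ` C = {0}"

text \<open>
  A neighborhood of a point is any set, not necessarily open, that contains the point in
  its interior. The difference \<open>V - C\<close> is spelled out because \<open>-\<close> on sets is the
  set-theoretic difference.
\<close>

definition cone_usc_at ::
  "'z::real_topological_vector_space set \<Rightarrow> 'x::topological_space set \<Rightarrow> ('x \<Rightarrow> 'z) \<Rightarrow> 'x \<Rightarrow> bool"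
  where
  "cone_usc_at C K h x \<longleftrightarrow>
     (\<forall>V. h x \<in> interior V \<longrightarrow>
        (\<exists>U. x \<in> interior U \<and> (\<forall>u \<in> U \<inter> K. h u \<in> {v - c | v c. v \<in> V \<and> c \<in> C})))"

definition cone_usc_on ::
  "'z::real_topological_vector_space set \<Rightarrow> 'x::topological_space set \<Rightarrow> ('x \<Rightarrow> 'z) \<Rightarrow> bool"
  where
  "cone_usc_on C K h \<longleftrightarrow> (\<forall>x\<in>K. cone_usc_at C K h x)"

text \<open>
  The pair \<open>(i, j) \<in> r\<close> means that \<open>j\<close> lies beyond \<open>i\<close>. A net is a function on \<open>I\<close>;
  its values outside \<open>I\<close> are irrelevant.
\<close>

definition directed_set :: "'i set \<Rightarrow> 'i rel \<Rightarrow> bool" where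
  "directed_set I r \<longleftrightarrow>
     I \<noteq> {} \<and> preorder_on I r \<and> (\<forall>i\<in>I. \<forall>j\<in>I. \<exists>k\<in>I. (i, k) \<in> r \<and> (j, k) \<in> r)"

definition net_converges ::
  "'i set \<Rightarrow> 'i rel \<Rightarrow> ('i \<Rightarrow> 'a::topological_space) \<Rightarrow> 'a \<Rightarrow> bool" where
  "net_converges I r f l \<longleftrightarrow>
     (\<forall>U. l \<in> interior U \<longrightarrow> (\<exists>i\<in>I. \<forall>j\<in>I. (i, j) \<in> r \<longrightarrow> f j \<in> U))"

text \<open>
  HOL cannot quantify over all index types inside a formula. The nets here are indexed by
  arbitrary directed sets of subsets of the domain, which include the neighborhood systems
  of points. Since this is a condition on fewer nets, it is implied by the condition on
  all nets, and a theorem assuming it covers the latter.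
\<close>

definition net_condition ::
  "'z::real_topological_vector_space set \<Rightarrow> 'x::topological_space set \<Rightarrow> ('x \<Rightarrow> 'z) \<Rightarrow> bool"
  where
  "net_condition C K h \<longleftrightarrow>
     (\<forall>x\<in>K. \<forall>(I :: 'x set set) r xs.
        directed_set I r \<and> (\<forall>\<alpha>\<in>I. xs \<alpha> \<in> K) \<and> net_converges I r xs x \<longrightarrow>
        (\<exists>zs z. net_converges I r zs z \<and>
           (\<forall>\<alpha>\<in>I. h (xs \<alpha>) - zs \<alpha> \<in> uminus ` C) \<and> h x - z \<in> C))"

definition G_set ::
  "'z::real_topological_vector_space set \<Rightarrow> 'x set \<Rightarrow> ('x \<Rightarrow> 'x \<Rightarrow> 'z) \<Rightarrow> 'x \<Rightarrow> 'x set" where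
  "G_set C K g y = {x \<in> K. g x y \<notin> uminus ` interior C}"

end

theory Submission
  imports Defs
begin

text \<open>
  If \<open>C + C = C\<close>, then \<open>interior C + C \<subseteq> interior C\<close>, so the open set \<open>- interior C\<close> is stable
  under subtracting elements of \<open>C\<close>. Under (a), it can itself serve as the neighborhood \<open>V\<close>.
  Under (b), a point \<open>x\<close> in the closure of \<open>G\<^sub>g(y)\<close> is the limit of a net in \<open>G\<^sub>g(y)\<close> indexed by
  the open neighborhoods of \<open>x\<close>; if \<open>g(x,y) \<in> - interior C\<close>, then \<open>z \<in> - interior C\<close>,
  hence some \<open>z\<^sub>\<alpha> \<in> - interior C\<close> and so \<open>g(x\<^sub>\<alpha>,y) \<in> - interior C\<close>, a contradiction.
\<close>

text \<open>The translate of \<open>interior C\<close> by \<open>c\<close> is open, contains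
  \<open>a + c\<close> and lies in \<open>C + C\<close>, hence in \<open>C\<close>.\<close>

lemma interior_add_closed:
  fixes C :: "'z::topological_group_add set"
  assumes "C + C \<subseteq> C" "a \<in> interior C" "c \<in> C"
  shows "a + c \<in> interior C"
proof (rule interiorI)
  show "open ((\<lambda>z. z - c) -` interior C)"
    by (intro open_vimage open_interior continuous_intros)
  show "a + c \<in> (\<lambda>z. z - c) -` interior C"
    using assms(2) by simp
  show "(\<lambda>z. z - c) -` interior C \<subseteq> C"
  proof
    fix z assume "z \<in> (\<lambda>z. z - c) -` interior C"
    then have "z - c \<in> C"
      using interior_subset by auto
    then have "(z - c) + c \<in> C + C"
      using assms(3) by (rule set_plus_intro)
    then show "z \<in> C"
      using assms(1) by auto
  qed
qed

lemma uminus_image_iff: "z \<in> uminus ` A \<longleftrightarrow> - z \<in> A" for z :: "'a::group_add"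
  by (auto intro: image_eqI[of _ _ "- z"])

lemma open_uminus_interior:
  fixes C :: "'z::topological_group_add set"
  shows "open (uminus ` interior C)"
proof -
  have "uminus ` interior C = uminus -` interior C"
    by (auto simp: uminus_image_iff)
  moreover have "open (uminus -` interior C)"
    by (intro open_vimage open_interior continuous_intros)
  ultimately show ?thesis
    by simp
qed

text \<open>This is \<open>interior_add_closed\<close> after a change of sign, since
  \<open>- (v - c) = - v + c\<close>.\<close>

lemma diff_mem_uminus_interior:
  fixes C :: "'z::topological_ab_group_add set"
  assumes "C + C \<subseteq> C" "v \<in> uminus ` interior C" "c \<in> C"
  shows "v - c \<in> uminus ` interior C"
  using interior_add_closed[OF assms(1) _ assms(3), of "- v"] assms(2)
  by (simp add: uminus_image_iff add.commute)

text \<open>Choose a point of \<open>S\<close> in each open neighborhood of \<open>x\<close>,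
  smaller neighborhoods lying further along. The index type is the one over which
  \<open>net_condition\<close> quantifies.\<close>

lemma closure_imp_net:
  fixes S :: "'x::topological_space set"
  assumes "x \<in> closure S"
  obtains I :: "'x set set" and r xs
  where "directed_set I r" "\<forall>\<alpha>\<in>I. xs \<alpha> \<in> S" "net_converges I r xs x"
proof -
  define I where "I = {U. open U \<and> x \<in> U}"
  define r where "r = {(U, V). U \<in> I \<and> V \<in> I \<and> V \<subseteq> U}"
  have "\<exists>s. s \<in> U \<inter> S" if "U \<in> I" for U
    using assms that open_Int_closure_eq_empty[of U S] by (auto simp: I_def)
  then obtain xs where xs: "\<And>U. U \<in> I \<Longrightarrow> xs U \<in> U \<inter> S"
    by metis
  have "\<exists>W\<in>I. (U, W) \<in> r \<and> (V, W) \<in> r" if "U \<in> I" "V \<in> I" for U V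
    using that by (intro bexI[of _ "U \<inter> V"]) (auto simp: I_def r_def)
  moreover have "preorder_on I r"
    by (auto simp: preorder_on_def refl_on_def trans_def r_def)
  moreover have "UNIV \<in> I"
    by (simp add: I_def)
  ultimately have "directed_set I r"
    unfolding directed_set_def by blast
  moreover have "net_converges I r xs x"
    unfolding net_converges_def
  proof (intro allI impI)
    fix U assume "x \<in> interior U"
    \<comment> \<open>\<open>U\<close> need not be open, so its interior serves as the index beyond
      which the net stays in \<open>U\<close>.\<close>
    then have "interior U \<in> I"
      by (simp add: I_def)
    moreover have "xs V \<in> U" if "V \<in> I" "(interior U, V) \<in> r" for V
      using xs[OF that(1)] that(2) interior_subset by (auto simp: r_def)
    ultimately show "\<exists>i\<in>I. \<forall>j\<in>I. (i, j) \<in> r \<longrightarrow> xs j \<in> U"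
      by blast
  qed
  ultimately show thesis
    using that xs by blast
qed

lemma net_converges_open:
  assumes "directed_set I r" "net_converges I r f l" "open U" "l \<in> U"
  obtains i where "i \<in> I" "f i \<in> U"
proof -
  obtain i where i: "i \<in> I" "\<forall>j\<in>I. (i, j) \<in> r \<longrightarrow> f j \<in> U"
    using assms(2-4) unfolding net_converges_def by (metis interior_open)
  \<comment> \<open>Reflexivity makes \<open>i\<close> itself one of the indices beyond
    \<open>i\<close>.\<close>
  moreover have "(i, i) \<in> r"
    using assms(1) i(1) by (auto simp: directed_set_def preorder_on_def refl_on_def)
  ultimately show thesis
    using that by blast
qed

theorem lemma3p2:
  fixes C :: "'z::{real_topological_vector_space, t2_space} set"
    and K :: "'x::t2_space set"
    and y :: 'x
    and g :: "'x \<Rightarrow> 'x \<Rightarrow> 'z"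
  assumes "convex_pointed_cone C"
    and "interior C \<noteq> {}"
    and "K \<noteq> {}"
    and "closed K"
    and "y \<in> K"
    and "cone_usc_on C K (\<lambda>x. g x y) \<or> net_condition C K (\<lambda>x. g x y)"
  shows "closed (G_set C K g y)"
proof -
  let ?O = "uminus ` interior C" and ?G = "G_set C K g y"
  have "C + C \<subseteq> C"
    using assms(1) by (simp add: convex_pointed_cone_def)
  note stable = diff_mem_uminus_interior[OF this]
  have "x \<in> ?G" if x: "x \<in> closure ?G" for x
  proof (rule ccontr)
    assume "x \<notin> ?G"
    have "?G \<subseteq> K"
      by (auto simp: G_set_def)
    then have "x \<in> K"
      using x assms(4) closure_minimal by blast
    with \<open>x \<notin> ?G\<close> have gx: "g x y \<in> ?O"
      by (simp add: G_set_def)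
    from assms(6) show False
    proof
      assume "cone_usc_on C K (\<lambda>x. g x y)"
      then have "cone_usc_at C K (\<lambda>x. g x y) x"
        using \<open>x \<in> K\<close> by (simp add: cone_usc_on_def)
      moreover have "g x y \<in> interior ?O"
        using gx by (simp add: interior_open open_uminus_interior)
      ultimately obtain U where U: "x \<in> interior U"
        "\<forall>u \<in> U \<inter> K. g u y \<in> {v - c | v c. v \<in> ?O \<and> c \<in> C}"
        unfolding cone_usc_at_def by blast
      obtain u where "u \<in> interior U" "u \<in> ?G"
        using x U(1) open_Int_closure_eq_empty[of "interior U" ?G] by blast
      moreover from this have "u \<in> U \<inter> K"
        using interior_subset \<open>?G \<subseteq> K\<close> by blast
      \<comment> \<open>Here \<open>g u y = v - c\<close> with \<open>v\<close> in \<open>?O\<close>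
        and \<open>c\<close> in \<open>C\<close>.\<close>
      ultimately have "g u y \<in> ?O"
        using U(2) stable by force
      with \<open>u \<in> ?G\<close> show False
        by (simp add: G_set_def)
    next
      assume net: "net_condition C K (\<lambda>x. g x y)"
      obtain I :: "'x set set" and r xs where
        dir: "directed_set I r" and xs: "\<forall>\<alpha>\<in>I. xs \<alpha> \<in> ?G" and lim: "net_converges I r xs x"
        using closure_imp_net[OF x] by blast
      have "\<forall>\<alpha>\<in>I. xs \<alpha> \<in> K"
        using xs \<open>?G \<subseteq> K\<close> by blast
      then obtain zs z where zs: "net_converges I r zs z"
        "\<forall>\<alpha>\<in>I. g (xs \<alpha>) y - zs \<alpha> \<in> uminus ` C" "g x y - z \<in> C"
        using net[unfolded net_condition_def, rule_format, OF \<open>x \<in> K\<close>, of I r xs] dir lim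
        by auto
      \<comment> \<open>Write \<open>z\<close> as \<open>g x y - (g x y - z)\<close>, a point of
        \<open>?O\<close> minus an element of \<open>C\<close>.\<close>
      have "z \<in> ?O"
        using stable[OF gx zs(3)] by simp
      then obtain i where i: "i \<in> I" "zs i \<in> ?O"
        using net_converges_open[OF dir zs(1) open_uminus_interior] by blast
      have "zs i - g (xs i) y \<in> C"
        using zs(2) i(1) by (simp add: uminus_image_iff)
      \<comment> \<open>The same device gives
        \<open>g (xs i) y = zs i - (zs i - g (xs i) y)\<close>.\<close>
      from stable[OF i(2) this] have "g (xs i) y \<in> ?O"
        by simp
      then show False
        using xs i(1) by (simp add: G_set_def)
    qed
  qed
  then show ?thesis
    using closure_subset_eq by blast
qed

end
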